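(* Let $K$ be a field, $P=K[x_1,\dots,x_n]$, and let $I\subsetneq P$ be an ideal which satisfies $I:\langle x_1\cdots x_n\rangle^\infty=I$. Let $\Lambda\subseteq\mathbb Z^n$ be the unit lattice of $(x_1,\dots,x_n)$ modulo $I$, and let $\rho:\Lambda\to K^\times$ be its associated character. Then $\operatorname{Bin}(I)=I_{\Lambda,\rho}$. In particular, $\operatorname{Bin}(I)$ is a lattice ideal.
   Context: $\operatorname{Bin}(I)$ is the ideal generated by all monomials ($at$ with $a\in K\setminus\{0\}$, $t$ a term) and binomials ($as+bt$ with $a,b\in K\setminus\{0\}$, $s,t$ terms) contained in $I$, where a term is a product $x_1^{\alpha_1}\cdots x_n^{\alpha_n}$ with $\alpha_i\ge0$. For $a\in\mathbb Z^n$ write $a=a^+-a^-$ with $a_i^+=\max\{a_i,0\}$ and $a_i^-=\max\{-a_i,0\}$, and $X^b=x_1^{b_1}\cdots x_n^{b_n}$ for $b\in\mathbb N^n$. The unit lattice of $(x_1,\dots,x_n)$ modulo $I$ is $\Lambda=\{a\in\mathbb Z^n\mid X^{a^+}-g_aX^{a^-}\in I\text{ for some }g_a\in K^\times\}$; under the saturation hypothesis $g_a$ is unique, and its associated character is the group homomorphism $\rho:\Lambda\to K^\times$, $\rho(a)=g_a$. For a lattice $\Lambda\subseteq\mathbb Z^n$ and a character $\rho:\Lambda\to K^\times$ (group homomorphism), the lattice ideal associated to $(\Lambda,\rho)$ is $I_{\Lambda,\rho}=\langle X^{a^+}-\rho(a)X^{a^-}\mid a\in\Lambda\rangle\subseteq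 P$. *)

theory Defs
  imports "HOL-Analysis.Finite_Cartesian_Product" "HOL-Library.Poly_Mapping"
begin

subsection \<open>Ideals of a commutative ring\<close>

text \<open>Ideals are the submodules of a ring regarded as a module over itself:
  \<open>ring_module.subspace\<close> is the ideal predicate, \<open>ring_module.span\<close> the generated ideal.\<close>

global_interpretation ring_module: module "(*) :: 'a::comm_ring_1 \<Rightarrow> 'a \<Rightarrow> 'a"
  by standard (simp_all add: algebra_simps)

text \<open>As a rewrite rule this would reassociate products, against \<open>mult.assoc\<close>.\<close>

declare ring_module.scale_scale [simp del]

abbreviation is_ideal :: "'a::comm_ring_1 set \<Rightarrow> bool"
  where "is_ideal \<equiv> ring_module.subspace"

abbreviation ideal_gen :: "'a::comm_ring_1 set \<Rightarrow> 'a set"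
  where "ideal_gen \<equiv> ring_module.span"

definition ideal_prod :: "'a::comm_ring_1 set \<Rightarrow> 'a set \<Rightarrow> 'a set"
  where "ideal_prod I J = ideal_gen {f * g | f g. f \<in> I \<and> g \<in> J}"

primrec ideal_power :: "'a::comm_ring_1 set \<Rightarrow> nat \<Rightarrow> 'a set"
  where
    "ideal_power J 0 = UNIV"
  | "ideal_power J (Suc k) = ideal_prod J (ideal_power J k)"

definition ideal_colon :: "'a::comm_ring_1 set \<Rightarrow> 'a set \<Rightarrow> 'a set"
  where "ideal_colon I J = {f. \<forall>g\<in>J. f * g \<in> I}"

text \<open>The saturation \<open>I : J\<^sup>\<infinity>\<close>.\<close>

definition ideal_saturation :: "'a::comm_ring_1 set \<Rightarrow> 'a set \<Rightarrow> 'a set"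
  where "ideal_saturation I J = (\<Union>k. ideal_colon I (ideal_power J k))"


subsection \<open>Polynomials, monomials and binomials\<close>

text \<open>\<open>K[x\<^sub>1,\<dots>,x\<^sub>n]\<close> is the monoid algebra of \<open>\<nat>\<^sup>n\<close> over \<open>K\<close>: finitely supported maps
  from exponent vectors to coefficients, with convolution as multiplication.
  The indeterminates are indexed by the finite type \<open>'n\<close>.\<close>

type_synonym ('n, 'k) mpoly = "(nat ^ 'n) \<Rightarrow>\<^sub>0 'k"

text \<open>\<open>mon c b\<close> is \<open>c X\<^sup>b\<close>.\<close>

abbreviation mon :: "'k::zero \<Rightarrow> nat ^ 'n::finite \<Rightarrow> ('n, 'k) mpoly"
  where "mon c b \<equiv> Poly_Mapping.single b c"

definition var :: "'n::finite \<Rightarrow> ('n, 'k::zero_neq_one) mpoly"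
  where "var i = mon 1 (axis i 1)"

definition is_monomial :: "('n::finite, 'k::zero) mpoly \<Rightarrow> bool"
  where "is_monomial f \<longleftrightarrow> (\<exists>a t. a \<noteq> 0 \<and> f = mon a t)"

definition is_binomial :: "('n::finite, 'k::comm_monoid_add) mpoly \<Rightarrow> bool"
  where "is_binomial f \<longleftrightarrow> (\<exists>a b s t. a \<noteq> 0 \<and> b \<noteq> 0 \<and> f = mon a s + mon b t)"

definition Bin :: "('n::finite, 'k::field) mpoly set \<Rightarrow> ('n, 'k) mpoly set"
  where "Bin I = ideal_gen {f \<in> I. is_monomial f \<or> is_binomial f}"


subsection \<open>Lattices, characters and lattice ideals\<close>

definition pos_part :: "int ^ 'n::finite \<Rightarrow> nat ^ 'n"
  where "pos_part a = (\<chi> i. nat (max (a $ i) 0))"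

definition neg_part :: "int ^ 'n::finite \<Rightarrow> nat ^ 'n"
  where "neg_part a = (\<chi> i. nat (max (- (a $ i)) 0))"

text \<open>\<open>lattice_binomial a c\<close> is \<open>X\<^bsup>a+\<^esup> - c X\<^bsup>a-\<^esup>\<close>.\<close>

definition lattice_binomial :: "int ^ 'n::finite \<Rightarrow> 'k::field \<Rightarrow> ('n, 'k) mpoly"
  where "lattice_binomial a c = mon 1 (pos_part a) - mon c (neg_part a)"

text \<open>Lattices are arbitrary subgroups of \<open>\<int>\<^sup>n\<close>, not necessarily of full rank.\<close>

definition is_lattice :: "(int ^ 'n::finite) set \<Rightarrow> bool"
  where "is_lattice \<Lambda> \<longleftrightarrow>
    0 \<in> \<Lambda> \<and> (\<forall>a\<in>\<Lambda>. \<forall>b\<in>\<Lambda>. a + b \<in> \<Lambda>) \<and> (\<forall>a\<in>\<Lambda>. - a \<in> \<Lambda>)"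

definition is_character :: "(int ^ 'n::finite) set \<Rightarrow> (int ^ 'n \<Rightarrow> 'k::field) \<Rightarrow> bool"
  where "is_character \<Lambda> \<rho> \<longleftrightarrow>
    (\<forall>a\<in>\<Lambda>. \<rho> a \<noteq> 0) \<and> (\<forall>a\<in>\<Lambda>. \<forall>b\<in>\<Lambda>. \<rho> (a + b) = \<rho> a * \<rho> b)"

definition lattice_ideal ::
    "(int ^ 'n::finite) set \<Rightarrow> (int ^ 'n \<Rightarrow> 'k::field) \<Rightarrow> ('n, 'k) mpoly set"
  where "lattice_ideal \<Lambda> \<rho> = ideal_gen {lattice_binomial a (\<rho> a) | a. a \<in> \<Lambda>}"

definition is_lattice_ideal :: "('n::finite, 'k::field) mpoly set \<Rightarrow> bool"
  where "is_lattice_ideal J \<longleftrightarrow>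
    (\<exists>\<Lambda> \<rho>. is_lattice \<Lambda> \<and> is_character \<Lambda> \<rho> \<and> J = lattice_ideal \<Lambda> \<rho>)"

definition unit_lattice :: "('n::finite, 'k::field) mpoly set \<Rightarrow> (int ^ 'n) set"
  where "unit_lattice I = {a. \<exists>g. g \<noteq> 0 \<and> lattice_binomial a g \<in> I}"

text \<open>The description is proper on \<open>unit_lattice I\<close> when \<open>I\<close> is a proper saturated ideal
  (\<open>unit_lattice_unique\<close>); values outside \<open>unit_lattice I\<close> are irrelevant.\<close>

definition unit_character :: "('n::finite, 'k::field) mpoly set \<Rightarrow> int ^ 'n \<Rightarrow> 'k"
  where "unit_character I a = (THE g. g \<noteq> 0 \<and> lattice_binomial a g \<in> I)"


subsection \<open>Well-definedness of the associated character\<close>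

lemma mon_power: "mon (c::'k::comm_ring_1) b ^ k = mon (c ^ k) (of_nat k * b)"
  by (induction k) (simp_all add: mult_single algebra_simps)

lemma mon_eq_prod_var:
  fixes b :: "nat ^ 'n::finite"
  shows "(mon 1 b :: ('n, 'k::comm_ring_1) mpoly) = (\<Prod>i\<in>UNIV. var i ^ (b $ i))"
proof -
  have prod: "(\<Prod>i\<in>A. mon 1 (f i) :: ('n, 'k) mpoly) = mon 1 (\<Sum>i\<in>A. f i)"
    if "finite A" for A :: "'n set" and f
    using that by induction (simp_all add: mult_single)
  have "(\<Sum>i\<in>UNIV. of_nat (b $ i) * axis i 1) = b"
    by (simp add: vec_eq_iff axis_def of_nat_index if_distrib[of "\<lambda>x. _ * x"] cong: if_cong)
  then show ?thesis
    by (simp add: var_def mon_power prod)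
qed

lemma ideal_power_principal:
  fixes h :: "'a::comm_ring_1"
  shows "ideal_power (ideal_gen {h}) k \<subseteq> range (\<lambda>q. q * h ^ k)"
proof (induction k)
  case (Suc k)
  have "ring_module.subspace (range (\<lambda>q. q * h ^ Suc k))"
    unfolding ring_module.subspace_def
  proof (intro conjI ballI allI)
    show "0 \<in> range (\<lambda>q. q * h ^ Suc k)"
      by (rule range_eqI[of _ _ 0]) simp
  next
    fix x y assume "x \<in> range (\<lambda>q. q * h ^ Suc k)" "y \<in> range (\<lambda>q. q * h ^ Suc k)"
    then obtain p q where "x = p * h ^ Suc k" "y = q * h ^ Suc k"
      by (elim rangeE)
    then show "x + y \<in> range (\<lambda>q. q * h ^ Suc k)"
      by (intro range_eqI[of _ _ "p + q"]) (simp add: algebra_simps)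
  next
    fix c x assume "x \<in> range (\<lambda>q. q * h ^ Suc k)"
    then obtain p where "x = p * h ^ Suc k"
      by (elim rangeE)
    then show "c * x \<in> range (\<lambda>q. q * h ^ Suc k)"
      by (intro range_eqI[of _ _ "c * p"]) (simp add: algebra_simps)
  qed
  moreover have "{f * g | f g. f \<in> ideal_gen {h} \<and> g \<in> ideal_power (ideal_gen {h}) k}
      \<subseteq> range (\<lambda>q. q * h ^ Suc k)"
  proof safe
    fix f g assume "f \<in> ideal_gen {h}" "g \<in> ideal_power (ideal_gen {h}) k"
    from this(1) obtain p where "f = p * h"
      by (auto simp: ring_module.span_singleton)
    from Suc \<open>g \<in> _\<close> have "g \<in> range (\<lambda>q. q * h ^ k)"
      by (rule subsetD)
    then obtain q where "g = q * h ^ k"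
      by (elim rangeE)
    with \<open>f = p * h\<close> show "f * g \<in> range (\<lambda>q. q * h ^ Suc k)"
      by (intro range_eqI[of _ _ "p * q"]) (simp add: algebra_simps)
  qed
  ultimately show ?case
    by (simp add: ideal_prod_def ring_module.span_minimal)
qed simp

lemma saturated_cancel:
  fixes I :: "('n::finite, 'k::field) mpoly set"
  assumes "is_ideal I" and sat: "ideal_saturation I (ideal_gen {\<Prod>i\<in>UNIV. var i}) = I"
    and f: "mon c b * f \<in> I" and "c \<noteq> 0"
  shows "f \<in> I"
proof -
  define k where "k = (\<Sum>i\<in>UNIV. b $ i)"
  have le: "b $ i \<le> k" for i
    unfolding k_def by (rule member_le_sum) auto
  define d :: "nat ^ 'n" where "d = (\<chi> i. k - b $ i)"
  have pk: "(\<Prod>i\<in>UNIV. var i :: ('n, 'k) mpoly) ^ k = mon (1 / c) d * mon c b"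
  proof -
    have "(\<Prod>i\<in>UNIV. var i :: ('n, 'k) mpoly) ^ k = (\<Prod>i\<in>UNIV. var i ^ ((\<chi> i. k :: nat ^ 'n) $ i))"
      by (simp add: prod_power_distrib)
    also have "\<dots> = mon 1 (\<chi> i. k)"
      by (rule mon_eq_prod_var[symmetric])
    also have "(\<chi> i. k) = d + b"
      using le by (simp add: d_def vec_eq_iff)
    also have "mon 1 (d + b) = mon (1 / c) d * mon c b"
      using \<open>c \<noteq> 0\<close> by (simp add: mult_single)
    finally show ?thesis .
  qed
  have "f \<in> ideal_colon I (ideal_power (ideal_gen {\<Prod>i\<in>UNIV. var i}) k)"
    unfolding ideal_colon_def
  proof (intro CollectI ballI)
    fix g assume "g \<in> ideal_power (ideal_gen {\<Prod>i\<in>UNIV. var i :: ('n, 'k) mpoly}) k"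
    with ideal_power_principal have "g \<in> range (\<lambda>q. q * (\<Prod>i\<in>UNIV. var i) ^ k)"
      by (rule subsetD)
    then obtain q where "g = q * (\<Prod>i\<in>UNIV. var i) ^ k"
      by (elim rangeE)
    then have "f * g = (q * mon (1 / c) d) * (mon c b * f)"
      by (simp add: pk algebra_simps)
    then show "f * g \<in> I"
      using ring_module.subspace_scale[OF assms(1) f] by simp
  qed
  then show ?thesis
    using sat unfolding ideal_saturation_def by blast
qed

lemma unit_lattice_unique:
  fixes I :: "('n::finite, 'k::field) mpoly set"
  assumes "is_ideal I" "I \<noteq> UNIV" "ideal_saturation I (ideal_gen {\<Prod>i\<in>UNIV. var i}) = I"
    and "a \<in> unit_lattice I"
  shows "\<exists>!g. g \<noteq> 0 \<and> lattice_binomial a g \<in> I"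
proof -
  have "g = h" if "lattice_binomial a g \<in> I" "lattice_binomial a h \<in> I" for g h
  proof (rule ccontr)
    assume "g \<noteq> h"
    have "lattice_binomial a h - lattice_binomial a g \<in> I"
      using assms(1) that(2,1) by (rule ring_module.subspace_diff)
    then have "mon (g - h) (neg_part a) * 1 \<in> I"
      by (simp add: lattice_binomial_def single_diff)
    then have "1 \<in> I"
      using saturated_cancel assms(1,3) \<open>g \<noteq> h\<close> by fastforce
    then have "f \<in> I" for f
      using ring_module.subspace_scale[OF assms(1), of 1 f] by simp
    with assms(2) show False by blast
  qed
  with assms(4) show ?thesis
    unfolding unit_lattice_def by blast
qed

end

theory Submission
  imports Defs
begin

text \<open>Saturation makes monomials invertible as far as membership in \<open>I\<close> is concerned. Dividing
  \<open>X\<^sup>s - g X\<^sup>t\<close> by the greatest common divisor \<open>X\<^sup>m\<close> of its two terms leaves the lattice binomial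
  of \<open>s - t\<close> with the same coefficient \<open>g\<close>; so whether \<open>X\<^sup>s - g X\<^sup>t\<close> lies in \<open>I\<close> depends only on
  \<open>s - t\<close> and \<open>g\<close> (\<open>binomial_mem_iff\<close>).

  This gives both halves of the result. A proper saturated ideal contains no monomial, and each of
  its binomials is a monomial times some \<open>X\<^bsup>a+\<^esup> - \<rho>(a) X\<^bsup>a-\<^esup>\<close> with \<open>a\<close> in the unit lattice; as
  these generators are themselves binomials of \<open>I\<close>, the two ideals agree. And the relations
  \<open>X\<^bsup>a+\<^esup> \<equiv> g X\<^bsup>a-\<^esup>\<close> and \<open>X\<^bsup>b+\<^esup> \<equiv> h X\<^bsup>b-\<^esup>\<close> modulo \<open>I\<close> multiply to a relation with exponent
  difference \<open>a + b\<close> and coefficient \<open>g h\<close>, which makes the unit lattice a group and \<open>\<rho>\<close> a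
  homomorphism.\<close>

lemma pos_part_uminus: "pos_part (- a) = neg_part a"
  and neg_part_uminus: "neg_part (- a) = pos_part a"
  by (simp_all add: pos_part_def neg_part_def)

lemma int_pos_part_diff_neg_part: "int (pos_part a $ i) - int (neg_part a $ i) = a $ i"
  by (simp add: pos_part_def neg_part_def)

text \<open>Cancelling the componentwise minimum of \<open>s\<close> and \<open>t\<close> leaves exponents with disjoint supports,
  and these can only be the positive and negative parts of the difference.\<close>

lemma common_exponent:
  fixes s t :: "nat ^ 'n::finite"
  assumes "\<And>i. int (s $ i) - int (t $ i) = a $ i"
  obtains m where "s = m + pos_part a" "t = m + neg_part a"
proof
  let ?m = "\<chi> i. min (s $ i) (t $ i)"
  show "s = ?m + pos_part a" "t = ?m + neg_part a"
    using assms[symmetric] by (auto simp: vec_eq_iff pos_part_def neg_part_def)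
qed

lemma binomial_eq_mon_times_lattice_binomial:
  fixes s t :: "nat ^ 'n::finite"
  assumes "\<And>i. int (s $ i) - int (t $ i) = a $ i"
  obtains m where "\<And>g :: 'k::field. mon 1 s - mon g t = mon 1 m * lattice_binomial a g"
proof -
  obtain m where "s = m + pos_part a" "t = m + neg_part a"
    using assms by (rule common_exponent)
  then have "mon 1 s - mon g t = mon 1 m * lattice_binomial a g" for g :: 'k
    by (simp add: lattice_binomial_def algebra_simps mult_single)
  then show thesis
    by (rule that)
qed

locale proper_saturated_ideal =
  fixes I :: "('n::finite, 'k::field) mpoly set"
  assumes ideal: "is_ideal I"
    and proper: "I \<noteq> UNIV"
    and saturated: "ideal_saturation I (ideal_gen {\<Prod>i\<in>UNIV. var i}) = I"
begin

text \<open>Saturation would cancel a monomial of \<open>I\<close> down to \<open>1\<close>, and a proper ideal does not contain \<open>1\<close>.\<close>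

lemma not_monomial_mem:
  assumes "f \<in> I"
  shows "\<not> is_monomial f"
proof
  assume "is_monomial f"
  then obtain a t where "a \<noteq> 0" "f = mon a t"
    by (auto simp: is_monomial_def)
  with assms have "mon a t * 1 \<in> I"
    by simp
  then have "1 \<in> I"
    using \<open>a \<noteq> 0\<close> by (rule saturated_cancel[OF ideal saturated])
  then have "f \<in> I" for f
    using ring_module.subspace_scale[OF ideal, of 1 f] by simp
  with proper show False
    by blast
qed

lemma binomial_mem_iff:
  assumes "\<And>i. int (s $ i) - int (t $ i) = a $ i"
  shows "mon 1 s - mon g t \<in> I \<longleftrightarrow> lattice_binomial a g \<in> I"
proof -
  obtain m where m: "mon 1 s - mon g t = mon 1 m * lattice_binomial a g"
    using binomial_eq_mon_times_lattice_binomial[OF assms] by metis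
  show ?thesis
    unfolding m
  proof
    assume "mon 1 m * lattice_binomial a g \<in> I"
    then show "lattice_binomial a g \<in> I"
      by (rule saturated_cancel[OF ideal saturated]) simp
  qed (rule ring_module.subspace_scale[OF ideal])
qed

lemma unit_character_properties:
  assumes "a \<in> unit_lattice I"
  shows unit_character_nonzero: "unit_character I a \<noteq> 0"
    and lattice_binomial_unit_character: "lattice_binomial a (unit_character I a) \<in> I"
  using theI'[OF unit_lattice_unique[OF ideal proper saturated assms]]
  by (simp_all add: unit_character_def)

lemma unit_latticeI:
  assumes "g \<noteq> 0" and "lattice_binomial a g \<in> I"
  shows unit_lattice_mem: "a \<in> unit_lattice I"
    and unit_character_eq: "unit_character I a = g"
proof -
  show *: "a \<in> unit_lattice I"
    using assms by (auto simp: unit_lattice_def)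
  show "unit_character I a = g"
    unfolding unit_character_def
    using unit_lattice_unique[OF ideal proper saturated *] assms by (intro the1_equality) auto
qed

text \<open>The relations for \<open>a\<close> and \<open>b\<close> multiply to
  \<open>X\<^bsup>a+\<^esup> X\<^bsup>b+\<^esup> \<equiv> g h X\<^bsup>a-\<^esup> X\<^bsup>b-\<^esup>\<close>. Its exponents are in general not the positive and negative
  parts of \<open>a + b\<close>, but they have the right difference.\<close>

lemma lattice_binomial_add:
  assumes a: "lattice_binomial a g \<in> I" and b: "lattice_binomial b h \<in> I"
  shows "lattice_binomial (a + b) (g * h) \<in> I"
proof -
  let ?s = "pos_part a + pos_part b" and ?t = "neg_part a + neg_part b"
  have "mon 1 ?s - mon (g * h) ?t =
      mon 1 (pos_part b) * lattice_binomial a g + mon g (neg_part a) * lattice_binomial b h"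
    by (simp add: lattice_binomial_def algebra_simps mult_single)
  also have "\<dots> \<in> I"
    using ideal a b by (intro ring_module.subspace_add ring_module.subspace_scale)
  finally have "mon 1 ?s - mon (g * h) ?t \<in> I" .
  moreover have "int (?s $ i) - int (?t $ i) = (a + b) $ i" for i
    using int_pos_part_diff_neg_part[of a i] int_pos_part_diff_neg_part[of b i] by simp
  ultimately show ?thesis
    by (simp only: binomial_mem_iff)
qed

lemma lattice_binomial_uminus:
  assumes "g \<noteq> 0" and "lattice_binomial a g \<in> I"
  shows "lattice_binomial (- a) (inverse g) \<in> I"
proof -
  have "lattice_binomial (- a) (inverse g) = mon (- inverse g) 0 * lattice_binomial a g"
    using \<open>g \<noteq> 0\<close>
    by (simp add: lattice_binomial_def pos_part_uminus neg_part_uminus algebra_simps mult_single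
        single_uminus)
  then show ?thesis
    using ring_module.subspace_scale[OF ideal assms(2)] by simp
qed

lemma is_lattice_unit_lattice: "is_lattice (unit_lattice I)"
proof -
  have "lattice_binomial 0 1 = (0 :: ('n, 'k) mpoly)"
    by (simp add: lattice_binomial_def pos_part_def neg_part_def)
  then have "lattice_binomial 0 1 \<in> I"
    using ring_module.subspace_0[OF ideal] by simp
  then have "0 \<in> unit_lattice I"
    by (rule unit_lattice_mem[rotated]) simp
  moreover have "a + b \<in> unit_lattice I" if "a \<in> unit_lattice I" "b \<in> unit_lattice I" for a b
    using that[THEN unit_character_nonzero] that[THEN lattice_binomial_unit_character]
    by (intro unit_lattice_mem[OF _ lattice_binomial_add]) simp_all
  moreover have "- a \<in> unit_lattice I" if "a \<in> unit_lattice I" for a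
    using that lattice_binomial_uminus nonzero_imp_inverse_nonzero unfolding unit_lattice_def by blast
  ultimately show ?thesis
    by (simp add: is_lattice_def)
qed

lemma is_character_unit_character: "is_character (unit_lattice I) (unit_character I)"
  unfolding is_character_def
  by (simp add: unit_character_nonzero unit_character_eq lattice_binomial_add
      lattice_binomial_unit_character)

lemma binomial_mem_lattice_ideal:
  assumes "f \<in> I" and "is_binomial f"
  shows "f \<in> lattice_ideal (unit_lattice I) (unit_character I)"
proof -
  obtain c d s t where "c \<noteq> 0" "d \<noteq> 0" and f: "f = mon c s + mon d t"
    using \<open>is_binomial f\<close> by (auto simp: is_binomial_def)
  define a :: "int ^ 'n" where "a = (\<chi> i. int (s $ i) - int (t $ i))"
  \<comment> \<open>the coefficient once \<open>f\<close> is scaled so that \<open>X\<^sup>s\<close> has coefficient \<open>1\<close>\<close>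
  define g where "g = - (d / c)"
  have "g \<noteq> 0"
    using \<open>c \<noteq> 0\<close> \<open>d \<noteq> 0\<close> by (simp add: g_def)
  have diff: "int (s $ i) - int (t $ i) = a $ i" for i
    by (simp add: a_def)
  have f_scaled: "f = mon c 0 * (mon 1 s - mon g t)"
    using \<open>c \<noteq> 0\<close> by (simp add: f g_def algebra_simps mult_single single_uminus)
  then have "mon c 0 * (mon 1 s - mon g t) \<in> I"
    using \<open>f \<in> I\<close> by simp
  then have "mon 1 s - mon g t \<in> I"
    using \<open>c \<noteq> 0\<close> by (rule saturated_cancel[OF ideal saturated])
  then have mem: "lattice_binomial a g \<in> I"
    by (simp only: binomial_mem_iff[OF diff])
  then have "lattice_binomial a g \<in> lattice_ideal (unit_lattice I) (unit_character I)"
    unfolding lattice_ideal_def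
    using unit_latticeI[OF \<open>g \<noteq> 0\<close> mem] by (auto intro!: ring_module.span_base)
  moreover obtain m where "mon 1 s - mon g t = mon 1 m * lattice_binomial a g"
    using binomial_eq_mon_times_lattice_binomial[OF diff] by metis
  ultimately show ?thesis
    unfolding f_scaled lattice_ideal_def by (simp only: ring_module.span_scale)
qed

lemma is_binomial_lattice_binomial:
  assumes "g \<noteq> 0"
  shows "is_binomial (lattice_binomial a g)"
proof -
  have "lattice_binomial a g = mon 1 (pos_part a) + mon (- g) (neg_part a)"
    by (simp add: lattice_binomial_def single_uminus)
  moreover have "- g \<noteq> 0"
    using assms by simp
  ultimately show ?thesis
    unfolding is_binomial_def using one_neq_zero by blast
qed

lemma Bin_eq_lattice_ideal: "Bin I = lattice_ideal (unit_lattice I) (unit_character I)"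
proof
  show "Bin I \<subseteq> lattice_ideal (unit_lattice I) (unit_character I)"
    unfolding Bin_def
  proof (rule ring_module.span_minimal)
    show "{f \<in> I. is_monomial f \<or> is_binomial f}
        \<subseteq> lattice_ideal (unit_lattice I) (unit_character I)"
      using not_monomial_mem binomial_mem_lattice_ideal by blast
    show "is_ideal (lattice_ideal (unit_lattice I) (unit_character I))"
      by (simp add: lattice_ideal_def)
  qed
  show "lattice_ideal (unit_lattice I) (unit_character I) \<subseteq> Bin I"
    unfolding Bin_def lattice_ideal_def
    by (intro ring_module.span_mono)
      (auto simp: lattice_binomial_unit_character is_binomial_lattice_binomial
        unit_character_nonzero)
qed

end

theorem corollary4p9:
  fixes I :: "('n::finite, 'k::field) mpoly set"
    and \<Lambda> :: "(int ^ 'n) set"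
    and \<rho> :: "int ^ 'n \<Rightarrow> 'k"
  assumes "is_ideal I" and "I \<noteq> UNIV"
    and "ideal_saturation I (ideal_gen {\<Prod>i\<in>UNIV. var i}) = I"
    and "\<Lambda> = unit_lattice I"
    and "\<rho> = unit_character I"
  shows "Bin I = lattice_ideal \<Lambda> \<rho> \<and> is_lattice_ideal (Bin I)"
proof -
  interpret proper_saturated_ideal I
    using assms(1-3) by unfold_locales
  show ?thesis
    unfolding assms(4,5) is_lattice_ideal_def
    using Bin_eq_lattice_ideal is_lattice_unit_lattice is_character_unit_character by blast
qed

end
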